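(* Let $n\ge 1$, $N\ge 1$, and assume that $\varepsilon>0$ and $\tau>0$ satisfy $\tau/\varepsilon\le 1/\sqrt{n}$. Assume that for each $X\in\mathbb{Z}^n$ $$V_X(\lambda)=\frac{m^2}{2}\lambda+W_X(\lambda),$$ where $m>0$ and the real-valued function $W_X\in C^2(\mathbb{R})$ satisfies $W_X(\lambda)\ge 0$ for $\lambda\ge 0$. Then any solution $\psi:\mathbb{Z}^n\times\mathbb{Z}\to\mathbb{C}^N$ to the Cauchy problem for the equation $$\frac{\psi_X^{T+1}-2\psi_X^T+\psi_X^{T-1}}{\tau^2}=\sum_{j=1}^n\frac{\psi_{X+e_j}^T-2\psi_X^T+\psi_{X-e_j}^T}{\varepsilon^2}-B_X(|\psi_X^{T+1}|^2,|\psi_X^{T-1}|^2)\,(\psi_X^{T+1}+\psi_X^{T-1}),\qquad (X,T)\in\mathbb{Z}^n\times\mathbb{Z},$$ with arbitrary initial data $(\psi^0,\psi^1)\in l^2(\mathbb{Z}^n)\times l^2(\mathbb{Z}^n)$ (the values of $\psi^T$ at $T=0$ and $T=1$) satisfies the a priori estimate $$\|\psi^T\|_{l^2}^2\,\varepsilon^n\le\frac{4E^0}{m^2}\qquad\text{for all }T\in\mathbb{Z},$$ where $E^0$ is the value at $T=0$ of the discrete energy $$E^T=\sum_{X\in\mathbb{Z}^n}\Big[\Big(\frac{1}{\tau^2}-\frac{n}{\varepsilon^2}\Big)\frac{|\psi_X^{T+1}-\psi_X^T|^2}{2}+\sum_{j=1}^n\sum_{\pm}\frac{|\psi_X^{T+1}-\psi_{X\pm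 e_j}^T|^2}{4\varepsilon^2}+\frac{V_X(|\psi_X^{T+1}|^2)+V_X(|\psi_X^T|^2)}{2}\Big]\varepsilon^n .$$
   Context: $\psi_X^T$ denotes the value of $\psi$ at $(X,T)\in\mathbb{Z}^n\times\mathbb{Z}$, and $\psi^T$ the function $X\mapsto\psi_X^T$ on $\mathbb{Z}^n$. Here $e_1,\dots,e_n$ is the standard basis of $\mathbb{Z}^n$, $|\psi|^2=\bar\psi\cdot\psi$ for $\psi\in\mathbb{C}^N$, and $l^2(\mathbb{Z}^n)$ is the space of square-summable $\mathbb{C}^N$-valued functions on $\mathbb{Z}^n$ with $\|\phi\|_{l^2}^2=\sum_{X\in\mathbb{Z}^n}|\phi_X|^2$. Under the stated assumptions all terms in the series for $E^T$ are nonnegative, so $E^T$ is understood as an element of $[0,+\infty]$. For $X\in\mathbb{Z}^n$ and $\lambda,\mu\in\mathbb{R}$, $$B_X(\lambda,\mu)=\frac{V_X(\lambda)-V_X(\mu)}{\lambda-\mu}\ \text{ if }\lambda\ne\mu,\qquad B_X(\lambda,\lambda)=\partial_\lambda V_X(\lambda).$$ *)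

theory Defs
  imports "HOL-Analysis.Analysis"
begin

text \<open>
  The lattice \<open>\<int>\<^sup>n\<close> is \<^typ>\<open>int ^ 'n\<close> with \<open>n = CARD('n)\<close>, its basis vector \<open>e\<^sub>j\<close> is \<open>axis j 1\<close>, and
  the target space is \<^typ>\<open>complex ^ 'N\<close>, whose norm is the Hermitian one.  A field \<open>\<psi>\<close> takes
  its space argument first, so that \<open>\<psi> X T\<close> is the value at \<open>(X, T)\<close>.
\<close>

definition C2_real :: "(real \<Rightarrow> real) \<Rightarrow> bool" where
  "C2_real f \<longleftrightarrow> (\<exists>f' f''. (\<forall>x. (f has_real_derivative f' x) (at x)) \<and>
                          (\<forall>x. (f' has_real_derivative f'' x) (at x)) \<and>
                          continuous_on UNIV f'')"

definition in_l2 :: "(int ^ 'n \<Rightarrow> complex ^ 'N) \<Rightarrow> bool" where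
  "in_l2 \<phi> \<longleftrightarrow> (\<lambda>X. (norm (\<phi> X))\<^sup>2) summable_on UNIV"

text \<open>The squared norm is extended-valued: it is \<open>\<infinity>\<close> exactly when \<open>\<phi>\<close> is not square summable.\<close>

definition l2_norm_sq :: "(int ^ 'n \<Rightarrow> complex ^ 'N) \<Rightarrow> ennreal" where
  "l2_norm_sq \<phi> = (\<Sum>\<^sub>\<infinity>X. ennreal ((norm (\<phi> X))\<^sup>2))"

definition B :: "(int ^ 'n \<Rightarrow> real \<Rightarrow> real) \<Rightarrow> int ^ 'n \<Rightarrow> real \<Rightarrow> real \<Rightarrow> real" where
  "B V X l u = (if l \<noteq> u then (V X l - V X u) / (l - u) else deriv (V X) l)"

definition is_solution ::
  "real \<Rightarrow> real \<Rightarrow> (int ^ 'n \<Rightarrow> real \<Rightarrow> real) \<Rightarrow> (int ^ 'n \<Rightarrow> int \<Rightarrow> complex ^ 'N) \<Rightarrow> bool" where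
  "is_solution \<epsilon> \<tau> V \<psi> \<longleftrightarrow>
    (\<forall>X T. (\<psi> X (T + 1) - 2 *\<^sub>R \<psi> X T + \<psi> X (T - 1)) /\<^sub>R \<tau>\<^sup>2 =
       (\<Sum>j\<in>UNIV. (\<psi> (X + axis j 1) T - 2 *\<^sub>R \<psi> X T + \<psi> (X - axis j 1) T) /\<^sub>R \<epsilon>\<^sup>2)
       - B V X ((norm (\<psi> X (T + 1)))\<^sup>2) ((norm (\<psi> X (T - 1)))\<^sup>2)
           *\<^sub>R (\<psi> X (T + 1) + \<psi> X (T - 1)))"

definition energy_density ::
  "real \<Rightarrow> real \<Rightarrow> (int ^ 'n \<Rightarrow> real \<Rightarrow> real) \<Rightarrow> (int ^ 'n \<Rightarrow> int \<Rightarrow> complex ^ 'N)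
    \<Rightarrow> int \<Rightarrow> int ^ 'n \<Rightarrow> real" where
  "energy_density \<epsilon> \<tau> V \<psi> T X =
     (1 / \<tau>\<^sup>2 - real CARD('n) / \<epsilon>\<^sup>2) * ((norm (\<psi> X (T + 1) - \<psi> X T))\<^sup>2 / 2)
     + (\<Sum>j\<in>UNIV. (norm (\<psi> X (T + 1) - \<psi> (X + axis j 1) T))\<^sup>2 / (4 * \<epsilon>\<^sup>2)
                 + (norm (\<psi> X (T + 1) - \<psi> (X - axis j 1) T))\<^sup>2 / (4 * \<epsilon>\<^sup>2))
     + (V X ((norm (\<psi> X (T + 1)))\<^sup>2) + V X ((norm (\<psi> X T))\<^sup>2)) / 2"

text \<open>
  The sum of the series in \<open>[0, \<infinity>]\<close>.  Since \<^const>\<open>ennreal\<close> sends negative reals to \<open>0\<close>, this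
  is the intended value only if the density is nonnegative, which is the case if
  \<open>\<tau> / \<epsilon> \<le> 1 / sqrt n\<close> and every \<open>V X\<close> is nonnegative on \<open>[0, \<infinity>)\<close>.
\<close>

definition energy ::
  "real \<Rightarrow> real \<Rightarrow> (int ^ 'n \<Rightarrow> real \<Rightarrow> real) \<Rightarrow> (int ^ 'n \<Rightarrow> int \<Rightarrow> complex ^ 'N)
    \<Rightarrow> int \<Rightarrow> ennreal" where
  "energy \<epsilon> \<tau> V \<psi> T = (\<Sum>\<^sub>\<infinity>X. ennreal (energy_density \<epsilon> \<tau> V \<psi> T X * \<epsilon> ^ CARD('n)))"

end

theory Submission
  imports Defs
begin

text \<open>
  The energy is conserved exactly, without any decay at infinity.  Shifting the summation variable
  in each of the nonnegative hopping series moves the spatial shift from time \<open>T\<close> to time \<open>T + 1\<close>;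
  this says that \<open>E\<^sup>T\<close> is also an energy of the time-reversed field.  Pairing the equation with
  \<open>\<psi>\<^sup>T\<^sup>+\<^sup>1 - \<psi>\<^sup>T\<^sup>-\<^sup>1\<close> shows that the density of \<open>E\<^sup>T\<close> agrees pointwise with the shifted density of
  \<open>E\<^sup>T\<^sup>-\<^sup>1\<close>.  The bound follows since the potential terms dominate \<open>m\<^sup>2 / 4 * |\<psi>\<^sup>T|\<^sup>2\<close>.
\<close>

lemma norm_sq_diff_common:
  fixes u w c :: "'a :: real_inner"
  shows "(norm (u - c))\<^sup>2 - (norm (w - c))\<^sup>2 = inner (u - w) (u + w - 2 *\<^sub>R c)"
  by (simp add: power2_norm_eq_inner inner_diff_left inner_diff_right inner_add_left
      inner_add_right inner_commute algebra_simps)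

text \<open>Continuous additive maps commute with \<open>infsum\<close>. Multiplication by a finite
  \<open>c\<close> is continuous on [0, \<infinity>], whereas multiplication by \<open>top\<close>
  jumps at 0.\<close>

lemma infsum_cmult_ennreal:
  fixes f :: "'a \<Rightarrow> ennreal"
  assumes "c < top"
  shows "(\<Sum>\<^sub>\<infinity>x\<in>A. c * f x) = c * (\<Sum>\<^sub>\<infinity>x\<in>A. f x)"
proof -
  have "continuous_on UNIV (\<lambda>x. c * x)"
    using assms by (intro ennreal_continuous_on_cmult continuous_on_id)
  then have "isCont (\<lambda>x. c * x) (infsum f A)"
    by (simp add: continuous_on_eq_continuous_at)
  then have "infsum ((\<lambda>x. c * x) \<circ> f) A = c * infsum f A"
    by (intro infsum_comm_additive_general) (simp_all add: sum_distrib_left nonneg_summable_on_complete)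
  then show ?thesis by (simp add: o_def)
qed

lemma infsum_sum_ennreal:
  fixes f :: "'b \<Rightarrow> 'a \<Rightarrow> ennreal"
  shows "(\<Sum>\<^sub>\<infinity>x\<in>A. \<Sum>j\<in>J. f j x) = (\<Sum>j\<in>J. \<Sum>\<^sub>\<infinity>x\<in>A. f j x)"
  by (induction J rule: infinite_finite_induct) (simp_all add: infsum_add nonneg_summable_on_complete)

text \<open>Breaks an energy into separate series, so that each hopping series can be translated by
  its own vector. Nonnegativity makes \<open>ennreal\<close> additive on the summands.\<close>

lemma infsum_ennreal_add_sum:
  fixes k :: "'a \<Rightarrow> real" and h :: "'b \<Rightarrow> 'a \<Rightarrow> real"
  assumes "\<And>x. k x \<ge> 0" and "\<And>j x. h j x \<ge> 0"
  shows "(\<Sum>\<^sub>\<infinity>x. ennreal (k x + (\<Sum>j\<in>J. h j x)))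
       = (\<Sum>\<^sub>\<infinity>x. ennreal (k x)) + (\<Sum>j\<in>J. \<Sum>\<^sub>\<infinity>x. ennreal (h j x))"
proof -
  have "(\<Sum>\<^sub>\<infinity>x. ennreal (k x + (\<Sum>j\<in>J. h j x)))
      = (\<Sum>\<^sub>\<infinity>x. ennreal (k x) + (\<Sum>j\<in>J. ennreal (h j x)))"
    using assms by (simp add: ennreal_plus sum_nonneg sum_ennreal)
  also have "\<dots> = (\<Sum>\<^sub>\<infinity>x. ennreal (k x)) + (\<Sum>\<^sub>\<infinity>x. \<Sum>j\<in>J. ennreal (h j x))"
    by (intro infsum_add nonneg_summable_on_complete) simp_all
  finally show ?thesis by (simp only: infsum_sum_ennreal)
qed

lemma infsum_translate:
  fixes f :: "'a :: group_add \<Rightarrow> 'b :: {comm_monoid_add, t2_space}"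
  shows "(\<Sum>\<^sub>\<infinity>x. f (x + a)) = (\<Sum>\<^sub>\<infinity>x. f x)"
  by (rule infsum_reindex_bij_witness[where i = "\<lambda>x. x - a" and j = "\<lambda>x. x + a"]) auto

text \<open>At times \<open>- T - 1\<close> and \<open>- T\<close> the reversed field shows the
  slices \<open>T + 1\<close> and \<open>T\<close>, so both energies involve the same two slices in
  exchanged roles. All terms except the hops are symmetric in them.\<close>

lemma energy_time_reversal:
  fixes \<psi> :: "int ^ 'n \<Rightarrow> int \<Rightarrow> complex ^ 'N"
  assumes "\<epsilon> > 0" and coef: "real CARD('n) / \<epsilon>\<^sup>2 \<le> 1 / \<tau>\<^sup>2"
    and V: "\<And>X l. l \<ge> 0 \<Longrightarrow> V X l \<ge> 0"
  shows "energy \<epsilon> \<tau> V (\<lambda>X T. \<psi> X (- T)) (- T - 1) = energy \<epsilon> \<tau> V \<psi> T"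
proof -
  define k where "k = (\<lambda>X. ((1 / \<tau>\<^sup>2 - real CARD('n) / \<epsilon>\<^sup>2) * ((norm (\<psi> X (T + 1) - \<psi> X T))\<^sup>2 / 2)
     + (V X ((norm (\<psi> X (T + 1)))\<^sup>2) + V X ((norm (\<psi> X T))\<^sup>2)) / 2) * \<epsilon> ^ CARD('n))"
  \<comment> \<open>Two independent sites: \<open>Y\<close> lives at time \<open>T\<close>,
    \<open>X\<close> at time \<open>T + 1\<close>. The forward energy displaces \<open>Y\<close>
    from the summation site, the reversed one displaces \<open>X\<close>.\<close>
  define h where "h = (\<lambda>Y X. (norm (\<psi> X (T + 1) - \<psi> Y T))\<^sup>2 / (4 * \<epsilon>\<^sup>2) * \<epsilon> ^ CARD('n))"
  have k: "k X \<ge> 0" for X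
    using assms unfolding k_def by (intro mult_nonneg_nonneg add_nonneg_nonneg) auto
  have h: "h Y X \<ge> 0" for X Y
    using assms by (simp add: h_def)
  have split: "(\<Sum>\<^sub>\<infinity>X. ennreal (k X + (\<Sum>j\<in>UNIV. p j X + q j X)))
      = (\<Sum>\<^sub>\<infinity>X. ennreal (k X))
        + (\<Sum>j\<in>UNIV. (\<Sum>\<^sub>\<infinity>X. ennreal (p j X)) + (\<Sum>\<^sub>\<infinity>X. ennreal (q j X)))"
    if "\<And>j X. p j X \<ge> 0" "\<And>j X. q j X \<ge> 0" for p q :: "'n \<Rightarrow> int ^ 'n \<Rightarrow> real"
  proof -
    have "(\<Sum>\<^sub>\<infinity>X. ennreal (p j X + q j X))
        = (\<Sum>\<^sub>\<infinity>X. ennreal (p j X)) + (\<Sum>\<^sub>\<infinity>X. ennreal (q j X))" for j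
      \<comment> \<open>With a singleton index set the lemma is additivity for two series.\<close>
      using infsum_ennreal_add_sum[of "p j" "\<lambda>_. q j" "{()}"] that by simp
    then show ?thesis
      using infsum_ennreal_add_sum[of k "\<lambda>j X. p j X + q j X" UNIV] k that by simp
  qed
  have "energy_density \<epsilon> \<tau> V \<psi> T X * \<epsilon> ^ CARD('n)
      = k X + (\<Sum>j\<in>UNIV. h (X + axis j 1) X + h (X - axis j 1) X)" for X
    by (simp add: energy_density_def k_def h_def distrib_right sum_distrib_right)
  then have fwd: "energy \<epsilon> \<tau> V \<psi> T = (\<Sum>\<^sub>\<infinity>X. ennreal (k X))
      + (\<Sum>j\<in>UNIV. (\<Sum>\<^sub>\<infinity>X. ennreal (h (X + axis j 1) X)) + (\<Sum>\<^sub>\<infinity>X. ennreal (h (X - axis j 1) X)))"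
    by (simp add: energy_def split h)
  have "energy_density \<epsilon> \<tau> V (\<lambda>X T. \<psi> X (- T)) (- T - 1) X * \<epsilon> ^ CARD('n)
      = k X + (\<Sum>j\<in>UNIV. h X (X + axis j 1) + h X (X - axis j 1))" for X
    by (simp add: energy_density_def k_def h_def distrib_right sum_distrib_right
        norm_minus_commute add.commute)
  then have bwd: "energy \<epsilon> \<tau> V (\<lambda>X T. \<psi> X (- T)) (- T - 1) = (\<Sum>\<^sub>\<infinity>X. ennreal (k X))
      + (\<Sum>j\<in>UNIV. (\<Sum>\<^sub>\<infinity>X. ennreal (h X (X + axis j 1))) + (\<Sum>\<^sub>\<infinity>X. ennreal (h X (X - axis j 1))))"
    by (simp add: energy_def split h)
  \<comment> \<open>A hop by \<open>a\<close> in one energy becomes a hop by \<open>- a\<close> in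
    the other, so only the sum over both signs is preserved.\<close>
  have shift: "(\<Sum>\<^sub>\<infinity>X. ennreal (h X (X + a))) = (\<Sum>\<^sub>\<infinity>X. ennreal (h (X - a) X))"
    "(\<Sum>\<^sub>\<infinity>X. ennreal (h X (X - a))) = (\<Sum>\<^sub>\<infinity>X. ennreal (h (X + a) X))" for a
    using infsum_translate[of "\<lambda>X. ennreal (h (X - a) X)" a]
      infsum_translate[of "\<lambda>X. ennreal (h (X + a) X)" "- a"] by simp_all
  show ?thesis
    unfolding fwd bwd shift by (simp add: add.commute)
qed

text \<open>An exact discrete chain rule, valid on the diagonal too, where both sides vanish. It
  turns the nonlinear term into a difference of potentials.\<close>

lemma B_mult_diff: "B V X l u * (l - u) = V X l - V X u"
  by (simp add: B_def)

text \<open>Reversal at \<open>- T\<close> replaces slice \<open>T + 1\<close> by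
  \<open>T - 1\<close> but keeps slice \<open>T\<close> and its spatial neighbours. Each kinetic or
  hopping square thus changes from |u - c|^2 to |w - c|^2 with the same c, and the difference
  factors through \<open>u - w\<close>.\<close>

lemma energy_density_time_reversal:
  fixes \<psi> :: "int ^ 'n \<Rightarrow> int \<Rightarrow> complex ^ 'N"
  assumes "is_solution \<epsilon> \<tau> V \<psi>"
  shows "energy_density \<epsilon> \<tau> V \<psi> T X = energy_density \<epsilon> \<tau> V (\<lambda>X T. \<psi> X (- T)) (- T) X"
proof -
  define u w v where "u = \<psi> X (T + 1)" and "w = \<psi> X (T - 1)" and "v = \<psi> X T"
  define p q where "p = (\<lambda>j. \<psi> (X + axis j 1) T)" and "q = (\<lambda>j. \<psi> (X - axis j 1) T)"
  define b where "b = B V X ((norm u)\<^sup>2) ((norm w)\<^sup>2)"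
  have eq: "(u - 2 *\<^sub>R v + w) /\<^sub>R \<tau>\<^sup>2
      = (\<Sum>j\<in>UNIV. (p j - 2 *\<^sub>R v + q j) /\<^sub>R \<epsilon>\<^sup>2) - b *\<^sub>R (u + w)"
    using assms by (simp add: is_solution_def u_def w_def v_def p_def q_def b_def)
  have pot: "V X ((norm u)\<^sup>2) - V X ((norm w)\<^sup>2) = b * inner (u - w) (u + w)"
    using norm_sq_diff_common[of u 0 w] by (simp add: b_def flip: B_mult_diff)
  \<comment> \<open>\<open>inner\<close> is the real part of the Hermitian product, so the pairing
    is a real identity.\<close>
  have paired: "inner (u - w) (u + w - 2 *\<^sub>R v) / \<tau>\<^sup>2
      = (\<Sum>j\<in>UNIV. inner (u - w) (p j - 2 *\<^sub>R v + q j) / \<epsilon>\<^sup>2) - b * inner (u - w) (u + w)"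
    using arg_cong[OF eq, of "inner (u - w)"]
    by (simp add: inner_diff_right inner_sum_right inner_scaleR_right divide_inverse mult.commute
        algebra_simps)
  \<comment> \<open>The left side is free of \<open>v\<close>; inserting \<open>v\<close> so that it
    cancels produces the second differences in time and in direction \<open>j\<close> that occur in
    the equation.\<close>
  have hop: "(norm (u - p j))\<^sup>2 / (4 * \<epsilon>\<^sup>2) + (norm (u - q j))\<^sup>2 / (4 * \<epsilon>\<^sup>2)
      - ((norm (w - p j))\<^sup>2 / (4 * \<epsilon>\<^sup>2) + (norm (w - q j))\<^sup>2 / (4 * \<epsilon>\<^sup>2))
      = inner (u - w) (u + w - 2 *\<^sub>R v) / \<epsilon>\<^sup>2 / 2
        - inner (u - w) (p j - 2 *\<^sub>R v + q j) / \<epsilon>\<^sup>2 / 2" (is "?l = ?r") for j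
  proof -
    have "?l = (inner (u - w) (u + w - 2 *\<^sub>R p j) + inner (u - w) (u + w - 2 *\<^sub>R q j)) / (4 * \<epsilon>\<^sup>2)"
      unfolding norm_sq_diff_common[symmetric] by (simp add: add_divide_distrib diff_divide_distrib)
    also have "inner (u - w) (u + w - 2 *\<^sub>R p j) + inner (u - w) (u + w - 2 *\<^sub>R q j)
        = 2 * inner (u - w) (u + w - 2 *\<^sub>R v) - 2 * inner (u - w) (p j - 2 *\<^sub>R v + q j)"
      by (simp add: inner_diff_right inner_add_right)
    finally show ?thesis by (simp add: diff_divide_distrib)
  qed
  have "energy_density \<epsilon> \<tau> V \<psi> T X - energy_density \<epsilon> \<tau> V (\<lambda>X T. \<psi> X (- T)) (- T) X
      = (1 / \<tau>\<^sup>2 - real CARD('n) / \<epsilon>\<^sup>2) * (((norm (u - v))\<^sup>2 - (norm (w - v))\<^sup>2) / 2)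
        + (\<Sum>j\<in>UNIV. (norm (u - p j))\<^sup>2 / (4 * \<epsilon>\<^sup>2) + (norm (u - q j))\<^sup>2 / (4 * \<epsilon>\<^sup>2)
            - ((norm (w - p j))\<^sup>2 / (4 * \<epsilon>\<^sup>2) + (norm (w - q j))\<^sup>2 / (4 * \<epsilon>\<^sup>2)))
        + (V X ((norm u)\<^sup>2) - V X ((norm w)\<^sup>2)) / 2"
    unfolding energy_density_def u_def w_def v_def p_def q_def
    by (simp add: sum_subtractf right_diff_distrib diff_divide_distrib add_divide_distrib)
  also have "\<dots> = (1 / \<tau>\<^sup>2 - real CARD('n) / \<epsilon>\<^sup>2) * (inner (u - w) (u + w - 2 *\<^sub>R v) / 2)
        + (real CARD('n) * (inner (u - w) (u + w - 2 *\<^sub>R v) / \<epsilon>\<^sup>2 / 2)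
            - (\<Sum>j\<in>UNIV. inner (u - w) (p j - 2 *\<^sub>R v + q j) / \<epsilon>\<^sup>2) / 2)
        + b * inner (u - w) (u + w) / 2"
    unfolding hop pot norm_sq_diff_common by (simp add: sum_subtractf sum_divide_distrib)
  \<comment> \<open>The n directions contribute n / \<epsilon>^2 times half the time difference,
    cancelling the same amount subtracted in the kinetic coefficient. Half of the paired equation
    remains.\<close>
  also have "\<dots> = (inner (u - w) (u + w - 2 *\<^sub>R v) / \<tau>\<^sup>2
      - ((\<Sum>j\<in>UNIV. inner (u - w) (p j - 2 *\<^sub>R v + q j) / \<epsilon>\<^sup>2) - b * inner (u - w) (u + w))) / 2"
    by (simp add: left_diff_distrib diff_divide_distrib add_divide_distrib)
  also have "\<dots> = 0"
    unfolding paired by simp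
  finally show ?thesis by simp
qed

lemma energy_conserved:
  fixes \<psi> :: "int ^ 'n \<Rightarrow> int \<Rightarrow> complex ^ 'N"
  assumes "\<epsilon> > 0" and "real CARD('n) / \<epsilon>\<^sup>2 \<le> 1 / \<tau>\<^sup>2"
    and "\<And>X l. l \<ge> 0 \<Longrightarrow> V X l \<ge> 0" and "is_solution \<epsilon> \<tau> V \<psi>"
  shows "energy \<epsilon> \<tau> V \<psi> T = energy \<epsilon> \<tau> V \<psi> 0"
proof -
  have step: "energy \<epsilon> \<tau> V \<psi> T = energy \<epsilon> \<tau> V \<psi> (T - 1)" for T
  proof -
    have "energy \<epsilon> \<tau> V \<psi> T = energy \<epsilon> \<tau> V (\<lambda>X T. \<psi> X (- T)) (- T)"
      unfolding energy_def energy_density_time_reversal[OF assms(4), of T] ..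
    \<comment> \<open>The reversed time for \<open>T - 1\<close> is
      \<open>- (T - 1) - 1 = - T\<close>.\<close>
    also have "\<dots> = energy \<epsilon> \<tau> V \<psi> (T - 1)"
      using energy_time_reversal[OF assms(1-3), where \<psi> = \<psi> and T = "T - 1"] by simp
    finally show ?thesis .
  qed
  show ?thesis
  proof (induction T rule: int_induct[where k = 0])
    case (step1 i)
    then show ?case using step[of "i + 1"] by simp
  next
    case (step2 i)
    then show ?case using step[of i] by simp
  qed simp
qed

theorem theorem2p13:
  fixes \<epsilon> \<tau> m :: real
    and V W :: "int ^ 'n \<Rightarrow> real \<Rightarrow> real"
    and \<psi> :: "int ^ 'n \<Rightarrow> int \<Rightarrow> complex ^ 'N"
  assumes "\<epsilon> > 0" and "\<tau> > 0"
    and "\<tau> / \<epsilon> \<le> 1 / sqrt (real CARD('n))"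
    and "m > 0"
    and "\<And>X l. V X l = m\<^sup>2 / 2 * l + W X l"
    and "\<And>X. C2_real (W X)"
    and "\<And>X l. l \<ge> 0 \<Longrightarrow> W X l \<ge> 0"
    and "is_solution \<epsilon> \<tau> V \<psi>"
    and "in_l2 (\<lambda>X. \<psi> X 0)" and "in_l2 (\<lambda>X. \<psi> X 1)"
  shows "\<forall>T. l2_norm_sq (\<lambda>X. \<psi> X T) * ennreal (\<epsilon> ^ CARD('n))
           \<le> 4 * energy \<epsilon> \<tau> V \<psi> 0 / ennreal (m\<^sup>2)"
proof
  fix T
  \<comment> \<open>Squaring the step-size condition gives a nonnegative kinetic
    coefficient.\<close>
  have "(\<tau> / \<epsilon>)\<^sup>2 \<le> (1 / sqrt (real CARD('n)))\<^sup>2"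
    using assms(1-3) by (intro power_mono) auto
  then have coef: "real CARD('n) / \<epsilon>\<^sup>2 \<le> 1 / \<tau>\<^sup>2"
    using assms(1,2) by (simp add: power_divide field_simps)
  have Vlow: "V X l \<ge> m\<^sup>2 / 2 * l" if "l \<ge> 0" for X l
    using assms(5)[of X l] assms(7)[OF that, of X] by simp
  have V: "V X l \<ge> 0" if "l \<ge> 0" for X l
    using Vlow[OF that, of X] that order_trans[of 0 "m\<^sup>2 / 2 * l" "V X l"] by simp
  \<comment> \<open>The lower bound m^2 / 2 for the slope enters the density with weight 1/2;
    \<open>c\<close> is the reciprocal of m^2 / 4.\<close>
  define c where "c = 4 / m\<^sup>2"
  have c: "c > 0" using assms(4) by (simp add: c_def)
  have density: "(norm (\<psi> X T))\<^sup>2 \<le> c * energy_density \<epsilon> \<tau> V \<psi> T X" for X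
  proof -
    have "m\<^sup>2 / 2 * (norm (\<psi> X T))\<^sup>2 / 2 \<le> energy_density \<epsilon> \<tau> V \<psi> T X"
    proof -
      have "(1 / \<tau>\<^sup>2 - real CARD('n) / \<epsilon>\<^sup>2) * ((norm (\<psi> X (T + 1) - \<psi> X T))\<^sup>2 / 2) \<ge> 0"
        using coef by simp
      moreover have "(\<Sum>j\<in>UNIV. (norm (\<psi> X (T + 1) - \<psi> (X + axis j 1) T))\<^sup>2 / (4 * \<epsilon>\<^sup>2)
          + (norm (\<psi> X (T + 1) - \<psi> (X - axis j 1) T))\<^sup>2 / (4 * \<epsilon>\<^sup>2)) \<ge> 0"
        by (simp add: sum_nonneg)
      moreover have "m\<^sup>2 / 2 * (norm (\<psi> X T))\<^sup>2 / 2
          \<le> (V X ((norm (\<psi> X (T + 1)))\<^sup>2) + V X ((norm (\<psi> X T))\<^sup>2)) / 2"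
        using V[of "(norm (\<psi> X (T + 1)))\<^sup>2" X] Vlow[of "(norm (\<psi> X T))\<^sup>2" X] by simp
      ultimately show ?thesis
        unfolding energy_density_def by linarith
    qed
    then show ?thesis using assms(4) by (simp add: c_def field_simps)
  qed
  have "l2_norm_sq (\<lambda>X. \<psi> X T) * ennreal (\<epsilon> ^ CARD('n))
      = (\<Sum>\<^sub>\<infinity>X. ennreal ((norm (\<psi> X T))\<^sup>2) * ennreal (\<epsilon> ^ CARD('n)))"
    unfolding l2_norm_sq_def by (simp add: mult.commute[of _ "ennreal (\<epsilon> ^ CARD('n))"] infsum_cmult_ennreal)
  \<comment> \<open>The comparison takes place in [0, \<infinity>] and so covers infinite
    energy.\<close>
  also have "\<dots> \<le> (\<Sum>\<^sub>\<infinity>X. ennreal c * ennreal (energy_density \<epsilon> \<tau> V \<psi> T X * \<epsilon> ^ CARD('n)))"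
  proof (intro infsum_mono nonneg_summable_on_complete)
    fix X
    have "(norm (\<psi> X T))\<^sup>2 * \<epsilon> ^ CARD('n) \<le> c * (energy_density \<epsilon> \<tau> V \<psi> T X * \<epsilon> ^ CARD('n))"
      using mult_right_mono[OF density[of X], of "\<epsilon> ^ CARD('n)"] assms(1) by (simp add: mult.assoc)
    then show "ennreal ((norm (\<psi> X T))\<^sup>2) * ennreal (\<epsilon> ^ CARD('n))
        \<le> ennreal c * ennreal (energy_density \<epsilon> \<tau> V \<psi> T X * \<epsilon> ^ CARD('n))"
      using c assms(1) by (simp add: ennreal_mult'[symmetric] ennreal_mult''[symmetric] ennreal_leI)
  qed simp_all
  also have "\<dots> = ennreal c * energy \<epsilon> \<tau> V \<psi> T"
    unfolding energy_def by (simp add: infsum_cmult_ennreal)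
  also have "energy \<epsilon> \<tau> V \<psi> T = energy \<epsilon> \<tau> V \<psi> 0"
    using energy_conserved[OF assms(1) coef V assms(8)] .
  also have "ennreal c * energy \<epsilon> \<tau> V \<psi> 0 = 4 * energy \<epsilon> \<tau> V \<psi> 0 / ennreal (m\<^sup>2)"
  proof -
    \<comment> \<open>Here m^2 > 0 matters: 4 / 0 is 0 in the reals but \<open>top\<close> in
      \<open>ennreal\<close>.\<close>
    have "ennreal c = 4 / ennreal (m\<^sup>2)"
      using assms(4) by (simp add: c_def flip: divide_ennreal)
    then show ?thesis by (simp add: divide_ennreal_def mult_ac)
  qed
  finally show "l2_norm_sq (\<lambda>X. \<psi> X T) * ennreal (\<epsilon> ^ CARD('n))
      \<le> 4 * energy \<epsilon> \<tau> V \<psi> 0 / ennreal (m\<^sup>2)" .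
qed

end
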